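(* Let $n\ge1$. For each $\alpha\in Spec_{\mathcal B}(n)$ there are coprime integers $p,q$ with $1\le q\le p\le\left\lfloor\dfrac{(n+2)^{(n+2)/2}}{2^{n+1}}\right\rfloor$ and $\alpha=\dfrac pq$.
   Context: Let $N=\{1,\dots,n\}$ and let $\mathcal B_n$ be the set of all functions $f:2^N\to\{0,1\}$ with $f(\emptyset)=0$. For real weights write $w(S)=\sum_{i\in S}w_i$. For real $\alpha\ge 1$, $f\in\mathcal B_n$ is $\alpha$-roughly weighted if there are $w_1,\dots,w_n\in\mathbb R$ (negative values allowed) with $w(S)\ge 1$ for all $S\subseteq N$ with $f(S)=1$ and $w(S)\le\alpha$ for all $S\subseteq N$ with $f(S)=0$. The critical threshold value $\mu(f)$ is the smallest $\alpha\ge 1$ such that $f$ is $\alpha$-roughly weighted. Finally $Spec_{\mathcal B}(n)=\{\mu(f)\mid f\in\mathcal B_n\}$. *)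

theory Defs
  imports Complex_Main "HOL-Library.FuncSet"
begin

definition boolean_functions :: "nat \<Rightarrow> (nat set \<Rightarrow> nat) set" where
  "boolean_functions n = {f \<in> Pow {1..n} \<rightarrow>\<^sub>E {0, 1}. f {} = 0}"

text \<open>The weights are arbitrary reals. Only the values of \<open>w\<close> on \<open>{1..n}\<close> matter.\<close>

definition roughly_weighted :: "nat \<Rightarrow> real \<Rightarrow> (nat set \<Rightarrow> nat) \<Rightarrow> bool" where
  "roughly_weighted n \<alpha> f \<longleftrightarrow>
     (\<exists>w :: nat \<Rightarrow> real.
        (\<forall>S \<subseteq> {1..n}. f S = 1 \<longrightarrow> sum w S \<ge> 1) \<and>
        (\<forall>S \<subseteq> {1..n}. f S = 0 \<longrightarrow> sum w S \<le> \<alpha>))"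

definition critical_threshold :: "nat \<Rightarrow> (nat set \<Rightarrow> nat) \<Rightarrow> real" where
  "critical_threshold n f = (LEAST \<alpha>. \<alpha> \<ge> 1 \<and> roughly_weighted n \<alpha> f)"

definition Spec :: "nat \<Rightarrow> real set" where
  "Spec n = critical_threshold n ` boolean_functions n"

end

theory Submission
  imports Defs "Jordan_Normal_Form.Determinant"
begin

text \<open>Minimising \<open>\<alpha>\<close> is a linear program in \<open>n + 1\<close> variables whose polyhedron contains no
  line, so its minimum is attained at a basic point. By Cramer's rule the value there is a
  quotient of two 0/1 determinants of order \<open>n + 1\<close>, and Hadamard's inequality for the
  associated \<open>\<plusminus>1\<close> matrix of order \<open>n + 2\<close> bounds both of them.\<close>

section \<open>Hadamard's inequality by Gram-Schmidt orthogonalisation\<close>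

text \<open>One Gram-Schmidt step: \<open>c * v + u\<close> is the component of \<open>u\<close>
  orthogonal to \<open>v\<close>, and removing the parallel component cannot lengthen a
  vector.\<close>

lemma project_off:
  fixes u v :: "nat \<Rightarrow> real" and m :: nat
  defines "c \<equiv> - (\<Sum>j<m. u j * v j) / (\<Sum>j<m. (v j)\<^sup>2)"
  shows "(\<Sum>j<m. (c * v j + u j) * v j) = 0"
    and "(\<Sum>j<m. (c * v j + u j)\<^sup>2) \<le> (\<Sum>j<m. (u j)\<^sup>2)"
proof -
  define V where "V = (\<Sum>j<m. (v j)\<^sup>2)"
  define W where "W = (\<Sum>j<m. u j * v j)"
  have c: "c = - W / V" by (simp add: c_def V_def W_def)
  \<comment> \<open>For \<open>V = 0\<close> the quotient \<open>c\<close> takes the default value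
    0; this is still right because \<open>v\<close> then vanishes below \<open>m\<close>.\<close>
  have V0: "W = 0" if "V = 0"
  proof -
    have "\<forall>j\<in>{..<m}. (v j)\<^sup>2 = 0"
      using that unfolding V_def by (subst (asm) sum_nonneg_eq_0_iff) auto
    then show ?thesis by (auto simp: W_def intro!: sum.neutral)
  qed
  have cV: "c * V = - W" using V0 by (cases "V = 0") (auto simp: c)
  have "(\<Sum>j<m. (c * v j + u j) * v j) = c * V + W"
    by (simp add: V_def W_def sum_distrib_left sum.distrib algebra_simps power2_eq_square)
  then show "(\<Sum>j<m. (c * v j + u j) * v j) = 0" using cV by simp
  have "(\<Sum>j<m. (c * v j + u j)\<^sup>2) = (\<Sum>j<m. c\<^sup>2 * (v j)\<^sup>2 + 2 * c * (u j * v j) + (u j)\<^sup>2)"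
    by (rule sum.cong) (auto simp: power2_eq_square algebra_simps)
  also have "\<dots> = c * (c * V) + 2 * c * W + (\<Sum>j<m. (u j)\<^sup>2)"
    by (simp add: V_def W_def sum_distrib_left sum.distrib power2_eq_square mult.assoc)
  also have "\<dots> = c * W + (\<Sum>j<m. (u j)\<^sup>2)" by (simp add: cV)
  also have "c * W \<le> 0"
    using V_def by (auto simp: c sum_nonneg)
  finally show "(\<Sum>j<m. (c * v j + u j)\<^sup>2) \<le> (\<Sum>j<m. (u j)\<^sup>2)" by simp
qed

definition row_prod :: "real mat \<Rightarrow> nat \<Rightarrow> nat \<Rightarrow> real" where
  "row_prod A i k = (\<Sum>j<dim_col A. A $$ (i, j) * A $$ (k, j))"

text \<open>An intermediate state of Gram-Schmidt: row \<open>k\<close> is being processed and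
  \<open>l\<close> of its projections are done. Rows are never normalised, so each step is a row
  addition and keeps the determinant. For \<open>k = m\<close> and \<open>l = 0\<close> the last
  condition is vacuous and all rows are orthogonal.\<close>

definition orthogonalized :: "nat \<Rightarrow> real mat \<Rightarrow> nat \<Rightarrow> nat \<Rightarrow> real mat \<Rightarrow> bool" where
  "orthogonalized m A k l B \<longleftrightarrow> B \<in> carrier_mat m m \<and> det B = det A \<and>
     (\<forall>i<m. row_prod B i i \<le> row_prod A i i) \<and>
     (\<forall>i<k. \<forall>i'<i. row_prod B i i' = 0) \<and> (\<forall>i<l. row_prod B k i = 0)"

text \<open>Row \<open>k\<close> loses its projection onto row \<open>l\<close>. Its orthogonality
  to the rows before \<open>l\<close> survives because row \<open>l\<close> is itself orthogonal to
  them.\<close>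

lemma orthogonalized_step:
  assumes B: "orthogonalized m A k l B" and l: "l < k" and k: "k < m"
  shows "\<exists>B'. orthogonalized m A k (Suc l) B'"
proof -
  have Bc: "B \<in> carrier_mat m m" and dB: "det B = det A"
    and nB: "\<And>i. i < m \<Longrightarrow> row_prod B i i \<le> row_prod A i i"
    and oB: "\<And>i i'. i < k \<Longrightarrow> i' < i \<Longrightarrow> row_prod B i i' = 0"
    and lB: "\<And>i. i < l \<Longrightarrow> row_prod B k i = 0"
    using B by (auto simp: orthogonalized_def)
  define c where "c = - (\<Sum>j<m. B $$ (k,j) * B $$ (l,j)) / (\<Sum>j<m. (B $$ (l,j))\<^sup>2)"
  define B' where "B' = addrow c k l B"
  have B'c: "B' \<in> carrier_mat m m" using Bc by (auto simp: B'_def)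
  have entry: "B' $$ (i,j) = (if i = k then c * B $$ (l,j) + B $$ (k,j) else B $$ (i,j))"
    if "i < m" "j < m" for i j using that Bc by (auto simp: B'_def)
  have same: "row_prod B' i i' = row_prod B i i'" if "i < m" "i' < m" "i \<noteq> k" "i' \<noteq> k" for i i'
    using that Bc B'c by (auto simp: row_prod_def entry intro!: sum.cong)
  have kl: "row_prod B' k l = 0"
    using project_off(1)[where m = m and u = "\<lambda>j. B $$ (k,j)" and v = "\<lambda>j. B $$ (l,j)"] Bc B'c l k
    by (simp add: row_prod_def entry c_def)
  have kk: "row_prod B' k k \<le> row_prod B k k"
    using project_off(2)[where m = m and u = "\<lambda>j. B $$ (k,j)" and v = "\<lambda>j. B $$ (l,j)"] Bc B'c l k
    by (simp add: row_prod_def entry c_def power2_eq_square)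
  have ki: "row_prod B' k i = c * row_prod B l i + row_prod B k i" if "i < k" for i
    using that Bc B'c l k
    by (simp add: row_prod_def entry sum_distrib_left sum.distrib algebra_simps)
  have "orthogonalized m A k (Suc l) B'"
    unfolding orthogonalized_def
  proof (intro conjI allI impI)
    show "B' \<in> carrier_mat m m" by fact
    show "det B' = det A" using dB l k Bc by (simp add: B'_def det_addrow[of l m k])
    show "row_prod B' i i \<le> row_prod A i i" if "i < m" for i
      using kk nB[OF that] same[of i i] that by (cases "i = k") auto
    show "row_prod B' i i' = 0" if "i < k" "i' < i" for i i'
      using that same[of i i'] oB[of i i'] k by auto
    show "row_prod B' k i = 0" if "i < Suc l" for i
      using that kl ki[of i] l oB[of l i] lB[of i] by (cases "i = l") auto
  qed
  then show ?thesis by blast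
qed

lemma orthogonalized_exists:
  assumes A: "A \<in> carrier_mat m m" and "k \<le> m"
  shows "\<exists>B. orthogonalized m A k 0 B"
  using \<open>k \<le> m\<close>
proof (induction k)
  case 0
  then show ?case using A by (auto simp: orthogonalized_def)
next
  case (Suc k)
  have "\<exists>B. orthogonalized m A k l B" if "l \<le> k" for l
    using that
  proof (induction l)
    case 0
    then show ?case using Suc by auto
  next
    case (Suc l)
    then show ?case using orthogonalized_step[of m A k l] \<open>Suc k \<le> m\<close> by auto
  qed
  then obtain B where "orthogonalized m A k k B" by blast
  then have "orthogonalized m A (Suc k) 0 B"
    by (auto simp: orthogonalized_def less_Suc_eq)
  then show ?case by blast
qed

text \<open>Once the rows are orthogonal, the Gram matrix \<open>B * B\<^sup>T\<close> is triangular
  with the squared row lengths on its diagonal. Its determinant is the square of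
  \<open>det A\<close>, and no row became longer on the way.\<close>

theorem hadamard_inequality:
  fixes A :: "real mat"
  assumes A: "A \<in> carrier_mat m m"
  shows "(det A)\<^sup>2 \<le> (\<Prod>i<m. \<Sum>j<m. (A $$ (i,j))\<^sup>2)"
proof -
  obtain B where "orthogonalized m A m 0 B" using orthogonalized_exists[OF A] by blast
  then have B: "B \<in> carrier_mat m m" and dB: "det B = det A"
    and nB: "\<And>i. i < m \<Longrightarrow> row_prod B i i \<le> row_prod A i i"
    and oB: "\<And>i i'. i < m \<Longrightarrow> i' < i \<Longrightarrow> row_prod B i i' = 0"
    by (auto simp: orthogonalized_def)
  define G where "G = B * B\<^sup>T"
  have G: "G \<in> carrier_mat m m" using B by (auto simp: G_def)
  have entry: "G $$ (i,j) = row_prod B i j" if "i < m" "j < m" for i j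
    using B that by (auto simp: G_def row_prod_def scalar_prod_def intro!: sum.cong)
  have "(det A)\<^sup>2 = det G"
    using B by (simp add: G_def dB[symmetric] det_mult[of B m] det_transpose power2_eq_square)
  also have "\<dots> = prod_list (diag_mat G)"
    by (rule det_upper_triangular[OF _ G]) (use G entry oB in \<open>auto intro!: upper_triangularI\<close>)
  also have "\<dots> = (\<Prod>i<m. row_prod B i i)"
    using G entry by (auto simp: prod_list_diag_prod atLeast0LessThan intro!: prod.cong)
  also have "\<dots> \<le> (\<Prod>i<m. row_prod A i i)"
    by (rule prod_mono) (use nB in \<open>auto simp: row_prod_def[of B] intro!: sum_nonneg\<close>)
  also have "\<dots> = (\<Prod>i<m. \<Sum>j<m. (A $$ (i,j))\<^sup>2)"
    using A by (simp add: row_prod_def power2_eq_square)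
  finally show ?thesis .
qed

section \<open>Determinants of 0/1 matrices\<close>

text \<open>Hadamard's bound for 0/1 matrices of order \<open>m\<close>; at \<open>m = n + 1\<close>
  its floor is the bound on \<open>p\<close> in the theorem.\<close>

definition hadamard01 :: "nat \<Rightarrow> real" where
  "hadamard01 m = real (m + 1) powr (real (m + 1) / 2) / 2 ^ m"

text \<open>Bordering \<open>A\<close> by ones and subtracting the first row from the others of the resulting
  \<open>\<plusminus>1\<close> matrix leaves the block \<open>-2 A\<close>.\<close>

lemma det_01_bound:
  fixes A :: "real mat"
  assumes A: "A \<in> carrier_mat m m"
    and A01: "\<And>i j. i < m \<Longrightarrow> j < m \<Longrightarrow> A $$ (i,j) \<in> {0,1}"
  shows "\<bar>det A\<bar> \<le> hadamard01 m"
proof -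
  define J1 where "J1 = mat 1 m (\<lambda>_. 1 :: real)"
  define J2 where "J2 = mat m 1 (\<lambda>_. 1 :: real)"
  \<comment> \<open>The elimination is written as a factorisation: \<open>L\<close> undoes the row
    subtractions, so \<open>L * U\<close> is the bordered matrix, and both factors are block
    triangular.\<close>
  define L where "L = four_block_mat (1\<^sub>m 1) (0\<^sub>m 1 m) J2 (1\<^sub>m m)"
  define U where "U = four_block_mat (1\<^sub>m 1) J1 (0\<^sub>m m 1) ((-2) \<cdot>\<^sub>m A)"
  define B where "B = L * U"
  have J: "J1 \<in> carrier_mat 1 m" "J2 \<in> carrier_mat m 1" by (auto simp: J1_def J2_def)
  have LU: "L \<in> carrier_mat (1 + m) (1 + m)" "U \<in> carrier_mat (1 + m) (1 + m)"
    using A J unfolding L_def U_def by auto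
  have "B = four_block_mat (1\<^sub>m 1) J1 J2 (J2 * J1 + (-2) \<cdot>\<^sub>m A)"
    unfolding B_def L_def U_def
    by (subst mult_four_block_mat[of _ 1 1 _ m _ m _ _ 1 _ m]) (use A J in auto)
  moreover have "(1 - 2 * A $$ (i,j))\<^sup>2 = 1" if "i < m" "j < m" for i j
    using A01[OF that] by auto
  ultimately have sq: "(B $$ (i,j))\<^sup>2 = 1" if "i < m + 1" "j < m + 1" for i j
    using that A J by (cases i; cases j) (auto simp: J1_def J2_def scalar_prod_def)
  have "det L = 1" unfolding L_def
    by (subst det_four_block_mat_upper_right_zero[of _ 1 _ m]) (use J in auto)
  moreover have "det U = (-2) ^ m * det A" unfolding U_def
    by (subst det_four_block_mat_lower_left_zero[of _ 1 _ m]) (use J A in auto)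
  ultimately have dB: "det B = (-2) ^ m * det A"
    unfolding B_def by (subst det_mult[OF LU]) simp
  have "(det B)\<^sup>2 \<le> (\<Prod>i<m+1. \<Sum>j<m+1. (B $$ (i,j))\<^sup>2)"
    by (rule hadamard_inequality) (use LU in \<open>auto simp: B_def\<close>)
  also have "\<dots> = (\<Prod>i<m+1. real (m + 1))"
    by (rule prod.cong) (simp_all add: sq del: sum.lessThan_Suc)
  also have "\<dots> = real (m + 1) powr real (m + 1)"
    by (simp add: powr_realpow del: of_nat_add of_nat_Suc prod.lessThan_Suc)
  also have "\<dots> = (real (m + 1) powr (real (m + 1) / 2))\<^sup>2"
    by (simp add: power2_eq_square flip: powr_add)
  finally have "\<bar>det B\<bar> \<le> real (m + 1) powr (real (m + 1) / 2)"
    by (metis abs_le_square_iff abs_of_nonneg powr_ge_zero)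
  then show ?thesis
    by (simp add: dB abs_mult power_abs hadamard01_def field_simps)
qed

text \<open>An integer matrix has an integer determinant, so the real bound may be rounded
  down.\<close>

lemma det_01_int:
  fixes A :: "real mat"
  assumes A: "A \<in> carrier_mat m m"
    and A01: "\<And>i j. i < m \<Longrightarrow> j < m \<Longrightarrow> A $$ (i,j) \<in> {0,1}"
  obtains z :: int where "det A = of_int z" "\<bar>z\<bar> \<le> \<lfloor>hadamard01 m\<rfloor>"
proof -
  define Z where "Z = map_mat (\<lambda>x. if x = 0 then 0 else 1 :: int) A"
  have "A = map_mat of_int Z"
    by (rule eq_matI) (use A A01 in \<open>auto simp: Z_def\<close>)
  then have "det A = of_int (det Z)" by (simp add: of_int_hom.hom_det)
  moreover from this have "\<bar>det Z\<bar> \<le> \<lfloor>hadamard01 m\<rfloor>"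
    using det_01_bound[OF A A01] by (simp add: le_floor_iff)
  ultimately show ?thesis using that by blast
qed

section \<open>Basic points of a polyhedron\<close>

text \<open>Rows of the identity matrix are replaced one at a time: the determinant is the product
  of the new row with the cofactors of the old one, which do not all vanish.\<close>

lemma nonsingular_selection:
  fixes a :: "'i \<Rightarrow> nat \<Rightarrow> real"
  assumes ker: "\<And>d. (\<forall>i\<in>T. (\<Sum>j<m. a i j * d j) = 0) \<Longrightarrow> \<forall>j<m. d j = 0"
  obtains r where "\<And>i. i < m \<Longrightarrow> r i \<in> T" "det (mat m m (\<lambda>(i,j). a (r i) j)) \<noteq> 0"
proof -
  define M where "M k r = mat m m (\<lambda>(i,j). if i < k then a (r i) j else if i = j then 1 else 0)"
    for k and r :: "nat \<Rightarrow> 'i"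
  have "\<exists>r. (\<forall>i<k. r i \<in> T) \<and> det (M k r) \<noteq> 0" if "k \<le> m" for k
    using that
  proof (induction k)
    case 0
    have "M 0 r = 1\<^sub>m m" for r by (auto simp: M_def)
    then show ?case by simp
  next
    case (Suc k)
    then obtain r where r: "\<forall>i<k. r i \<in> T" and det: "det (M k r) \<noteq> 0" by auto
    have k: "k < m" using Suc by simp
    define c where "c j = cofactor (M k r) k j" for j
    have car: "M k' r' \<in> carrier_mat m m" for k' r' by (simp add: M_def)
    \<comment> \<open>The kernel hypothesis is applied to the vector of cofactors of row
      \<open>k\<close>; these do not depend on row \<open>k\<close> and so serve the old and the new
      matrix alike.\<close>
    have "\<exists>i\<in>T. (\<Sum>j<m. a i j * c j) \<noteq> 0"
    proof (rule ccontr)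
      assume "\<not> ?thesis"
      then have "\<forall>j<m. c j = 0" using ker by blast
      then have "det (M k r) = 0"
        by (subst laplace_expansion_row[OF car k]) (auto simp: c_def intro!: sum.neutral)
      with det show False by simp
    qed
    then obtain i where i: "i \<in> T" "(\<Sum>j<m. a i j * c j) \<noteq> 0" by blast
    define r' where "r' = r(k := i)"
    have "mat_delete (M (Suc k) r') k j = mat_delete (M k r) k j" for j
      by (rule eq_matI) (auto simp: mat_delete_def M_def r'_def)
    then have "det (M (Suc k) r') = (\<Sum>j<m. a i j * c j)"
      by (subst laplace_expansion_row[OF car k])
        (use k in \<open>auto simp: c_def cofactor_def M_def[of "Suc k"] r'_def intro!: sum.cong\<close>)
    moreover have "\<forall>i<Suc k. r' i \<in> T" using r i by (simp add: r'_def less_Suc_eq)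
    ultimately show ?case using i(2) by metis
  qed
  from this[of m] obtain r where r: "\<forall>i<m. r i \<in> T" "det (M m r) \<noteq> 0" by auto
  moreover have "M m r = mat m m (\<lambda>(i,j). a (r i) j)"
    by (rule eq_matI) (auto simp: M_def)
  ultimately show ?thesis using that by metis
qed

definition tight :: "'i set \<Rightarrow> nat \<Rightarrow> ('i \<Rightarrow> nat \<Rightarrow> real) \<Rightarrow> ('i \<Rightarrow> real) \<Rightarrow> (nat \<Rightarrow> real) \<Rightarrow> 'i set"
  where "tight I m a b x = {i\<in>I. (\<Sum>j<m. a i j * x j) = b i}"

text \<open>As long as the tight constraints have a common kernel direction, moving along it
  makes a further constraint tight.\<close>

lemma basic_feasible_point:
  fixes a :: "'i \<Rightarrow> nat \<Rightarrow> real"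
  assumes I: "finite I" and k: "k \<in> I"
    and pointed: "\<And>d. (\<forall>i\<in>I. (\<Sum>j<m. a i j * d j) = 0) \<Longrightarrow> \<forall>j<m. d j = 0"
    and feas: "\<forall>i\<in>I. (\<Sum>j<m. a i j * x j) \<ge> b i"
  shows "\<exists>y. (\<forall>i\<in>I. (\<Sum>j<m. a i j * y j) \<ge> b i) \<and>
    (\<Sum>j<m. a k j * y j) \<le> (\<Sum>j<m. a k j * x j) \<and>
    (\<forall>d. (\<forall>i\<in>tight I m a b y. (\<Sum>j<m. a i j * d j) = 0) \<longrightarrow> (\<forall>j<m. d j = 0))"
  using feas
proof (induction "card (I - tight I m a b x)" arbitrary: x rule: less_induct)
  case less
  define l where "l i d = (\<Sum>j<m. a i j * d j)" for i d
  have feas: "l i x \<ge> b i" if "i \<in> I" for i using less.prems that by (auto simp: l_def)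
  have l_add: "l i (\<lambda>j. y j + t * d j) = l i y + t * l i d" for i y t d
    by (simp add: l_def sum.distrib sum_distrib_left algebra_simps)
  show ?case
  proof (cases "\<forall>d. (\<forall>i\<in>tight I m a b x. l i d = 0) \<longrightarrow> (\<forall>j<m. d j = 0)")
    case True
    then show ?thesis using less.prems unfolding l_def by blast
  next
    case False
    then obtain d where d: "\<forall>i\<in>tight I m a b x. l i d = 0" "\<not> (\<forall>j<m. d j = 0)" by blast
    \<comment> \<open>The objective is itself the constraint \<open>k\<close>, hence bounded below.
      If it varies along \<open>d\<close>, choosing \<open>i0 = k\<close> lets one choice of sign
      for \<open>d\<close> both lower the objective and approach a constraint; otherwise any
      constraint that varies will do.\<close>
    obtain i0 where i0: "i0 \<in> I" "l i0 d \<noteq> 0" "l k d \<noteq> 0 \<longrightarrow> i0 = k"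
      using pointed[of d] d(2) k unfolding l_def by blast
    have "\<exists>e. (\<forall>i\<in>tight I m a b x. l i e = 0) \<and> l i0 e < 0 \<and> l k e \<le> 0"
    proof (cases "l i0 d < 0")
      case True
      then show ?thesis using d i0 by (intro exI[of _ d]) force
    next
      case False
      have "l i (\<lambda>j. - d j) = - l i d" for i by (simp add: l_def sum_negf)
      then show ?thesis using d i0 False by (intro exI[of _ "\<lambda>j. - d j"]) force
    qed
    then obtain e where e: "\<forall>i\<in>tight I m a b x. l i e = 0" "l i0 e < 0" "l k e \<le> 0" by blast
    define D where "D = {i\<in>I. l i e < 0}"
    have D: "finite D" "D \<noteq> {}" using I i0 e by (auto simp: D_def)
    \<comment> \<open>The ratio test of the simplex method: \<open>g i\<close> is the step length at
      which constraint \<open>i\<close> becomes tight, and the least of these is the longest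
      feasible step.\<close>
    define g where "g i = (l i x - b i) / (- l i e)" for i
    obtain i1 where i1: "i1 \<in> D" "\<And>i. i \<in> D \<Longrightarrow> g i1 \<le> g i"
      using D by (metis arg_min_if_finite(1) arg_min_least)
    define t where "t = g i1"
    have t0: "t \<ge> 0" using i1(1) feas by (auto simp: t_def g_def D_def intro!: divide_nonneg_neg)
    define y where "y = (\<lambda>j. x j + t * e j)"
    have ly: "l i y = l i x + t * l i e" for i by (simp add: y_def l_add)
    have yfeas: "l i y \<ge> b i" if "i \<in> I" for i
    proof (cases "l i e < 0")
      case True
      then have "t \<le> g i" using i1 that by (auto simp: t_def D_def)
      then have "t * (- l i e) \<le> l i x - b i" using True by (simp add: g_def pos_le_divide_eq neg_le_divide_eq field_simps)
      then show ?thesis by (simp add: ly)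
    next
      case False
      then have "t * l i e \<ge> 0" using t0 by simp
      then show ?thesis using feas[OF that] by (simp add: ly)
    qed
    have i1y: "l i1 y = b i1" using i1(1) by (simp add: ly t_def g_def D_def)
    have sub: "tight I m a b x \<subseteq> tight I m a b y"
      using e(1) ly by (auto simp: tight_def simp flip: l_def)
    moreover have "i1 \<in> tight I m a b y" "i1 \<notin> tight I m a b x"
      using i1 i1y e(1) by (auto simp: D_def tight_def simp flip: l_def)
    moreover have "i1 \<in> I" using i1(1) by (simp add: D_def)
    ultimately have "I - tight I m a b y \<subset> I - tight I m a b x" by blast
    then have "card (I - tight I m a b y) < card (I - tight I m a b x)"
      using I by (intro psubset_card_mono) auto
    from less.hyps[OF this] yfeas obtain z where
      z: "\<forall>i\<in>I. l i z \<ge> b i" "l k z \<le> l k y"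
         "\<forall>d. (\<forall>i\<in>tight I m a b z. l i d = 0) \<longrightarrow> (\<forall>j<m. d j = 0)"
      unfolding l_def by blast
    have "l k y \<le> l k x" using e(3) t0 by (simp add: ly mult_nonneg_nonpos)
    with z show ?thesis unfolding l_def by (intro exI[of _ z]) auto
  qed
qed

section \<open>The linear program of a Boolean function\<close>

lemma sum_indicator_01:
  fixes x :: "nat \<Rightarrow> real"
  assumes "S \<subseteq> {1..n}"
  shows "(\<Sum>j<Suc n. (if j = 0 then c else of_bool (j \<in> S)) * x j) = c * x 0 + sum x S"
proof -
  have "(\<Sum>j<Suc n. (if j = 0 then c else of_bool (j \<in> S)) * x j)
      = c * x 0 + (\<Sum>j=1..n. of_bool (j \<in> S) * x j)"
    by (subst sum.lessThan_Suc_shift)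
      (simp add: sum.shift_bounds_Suc_ivl[symmetric] sum.atLeast1_atMost_eq)
  also have "(\<Sum>j=1..n. of_bool (j \<in> S) * x j) = sum x S"
    using assms by (intro sum.mono_neutral_cong_right) auto
  finally show ?thesis .
qed

definition bounded_fractions :: "nat \<Rightarrow> real set" where
  "bounded_fractions m = (\<lambda>(p, q). real_of_int p / real_of_int q) `
     ({-\<lfloor>hadamard01 m\<rfloor>..\<lfloor>hadamard01 m\<rfloor>} \<times> ({-\<lfloor>hadamard01 m\<rfloor>..\<lfloor>hadamard01 m\<rfloor>} - {0}))"

text \<open>The linear program has the variables \<open>x 0 = -\<alpha>\<close> and \<open>x j = w j\<close>; with this sign a
  constraint of \<open>S\<close> is tight iff \<open>sum w S + (1 - f S) * x 0 = f S\<close>, so that both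
  determinants in Cramer's rule have entries 0 and 1.\<close>

lemma roughly_weighted_basic:
  assumes f: "f \<in> boolean_functions n" and rw: "roughly_weighted n \<alpha> f"
  shows "\<exists>\<beta>\<le>\<alpha>. roughly_weighted n \<beta> f \<and> \<beta> \<in> bounded_fractions (Suc n)"
proof -
  have f01: "f S = 0 \<or> f S = 1" if "S \<subseteq> {1..n}" for S
    using f that by (auto simp: boolean_functions_def PiE_iff)
  have f0: "f {} = 0" using f by (simp add: boolean_functions_def)
  define A :: "nat set \<Rightarrow> nat \<Rightarrow> real"
    where "A S j = (if j = 0 then 1 - real (f S) else of_bool (j \<in> S))" for S j
  \<comment> \<open>The sign turns the upper bounds for \<open>f S = 0\<close> into lower bounds. It
    is kept apart from \<open>A\<close> so that the matrix of tight constraints has entries 0 and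
    1.\<close>
  define s :: "nat set \<Rightarrow> real" where "s S = (if f S = 1 then 1 else -1)" for S
  define a where "a S j = s S * A S j" for S j
  define b :: "nat set \<Rightarrow> real" where "b S = real (f S)" for S
  have s0: "s S \<noteq> 0" for S by (simp add: s_def)
  have A_sum: "(\<Sum>j<Suc n. A S j * x j) = (1 - real (f S)) * x 0 + sum x S" if "S \<subseteq> {1..n}" for S x
    using sum_indicator_01[OF that, of "1 - real (f S)" x] by (simp only: A_def)
  have a_sum: "(\<Sum>j<Suc n. a S j * x j) = s S * ((1 - real (f S)) * x 0 + sum x S)"
    if "S \<subseteq> {1..n}" for S x
    unfolding A_sum[OF that, symmetric] a_def by (simp only: sum_distrib_left mult.assoc)
  have feasible_iff: "(\<forall>S\<in>Pow {1..n}. (\<Sum>j<Suc n. a S j * x j) \<ge> b S) \<longleftrightarrow>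
    (\<forall>S\<subseteq>{1..n}. f S = 1 \<longrightarrow> sum x S \<ge> 1) \<and> (\<forall>S\<subseteq>{1..n}. f S = 0 \<longrightarrow> sum x S \<le> - x 0)" for x
  proof -
    have "(\<Sum>j<Suc n. a S j * x j) \<ge> b S \<longleftrightarrow>
      (f S = 1 \<longrightarrow> sum x S \<ge> 1) \<and> (f S = 0 \<longrightarrow> sum x S \<le> - x 0)" if "S \<subseteq> {1..n}" for S
      using f01[OF that] by (auto simp only: a_sum[OF that]) (auto simp: s_def b_def)
    then show ?thesis by (auto simp only: Pow_iff Ball_def)
  qed
  obtain w where w: "\<forall>S\<subseteq>{1..n}. f S = 1 \<longrightarrow> sum w S \<ge> 1" "\<forall>S\<subseteq>{1..n}. f S = 0 \<longrightarrow> sum w S \<le> \<alpha>"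
    using rw by (auto simp: roughly_weighted_def)
  define x where "x = w(0 := - \<alpha>)"
  have "sum x S = sum w S" if "S \<subseteq> {1..n}" for S
    using that by (intro sum.cong) (auto simp: x_def)
  then have xfeas: "\<forall>S\<in>Pow {1..n}. (\<Sum>j<Suc n. a S j * x j) \<ge> b S"
    unfolding feasible_iff using w by (auto simp: x_def)
  \<comment> \<open>The empty set isolates the coordinate 0, since \<open>f {} = 0\<close>; after
    that each singleton isolates one weight.\<close>
  have pointed: "\<forall>j<Suc n. d j = 0" if *: "\<forall>S\<in>Pow {1..n}. (\<Sum>j<Suc n. a S j * d j) = 0" for d
  proof -
    have z: "(1 - real (f S)) * d 0 + sum d S = 0" if "S \<subseteq> {1..n}" for S
    proof -
      have "(\<Sum>j<Suc n. a S j * d j) = 0" using * that by blast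
      then show ?thesis using s0[of S] unfolding a_sum[OF that] by simp
    qed
    have d0: "d 0 = 0" using z[of "{}"] f0 by simp
    have "d j = 0" if "j \<in> {1..n}" for j using z[of "{j}"] d0 that by simp
    then show ?thesis using d0 by (metis One_nat_def Suc_leI atLeastAtMost_iff less_Suc_eq_le neq0_conv)
  qed
  \<comment> \<open>The constraint of the empty set reads \<open>- x 0 \<ge> 0\<close>, so its
    left-hand side is the threshold and serves as the objective.\<close>
  obtain y where yfeas: "\<forall>S\<in>Pow {1..n}. (\<Sum>j<Suc n. a S j * y j) \<ge> b S"
    and yle: "(\<Sum>j<Suc n. a {} j * y j) \<le> (\<Sum>j<Suc n. a {} j * x j)"
    and ker: "\<forall>d. (\<forall>S\<in>tight (Pow {1..n}) (Suc n) a b y. (\<Sum>j<Suc n. a S j * d j) = 0)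
      \<longrightarrow> (\<forall>j<Suc n. d j = 0)"
    using basic_feasible_point[where I = "Pow {1..n}" and k = "{}" and m = "Suc n" and a = a
        and x = x and b = b, OF _ _ pointed xfeas] by auto
  define \<beta> where "\<beta> = - y 0"
  have "\<beta> \<le> \<alpha>"
    using yle a_sum[of "{}" x] a_sum[of "{}" y] f0 by (simp add: \<beta>_def s_def x_def del: sum.lessThan_Suc)
  moreover have "roughly_weighted n \<beta> f"
    using yfeas unfolding feasible_iff roughly_weighted_def \<beta>_def by blast
  moreover have "\<beta> \<in> bounded_fractions (Suc n)"
  proof -
    let ?T = "tight (Pow {1..n}) (Suc n) a b y"
    obtain r where rT: "\<And>i. i < Suc n \<Longrightarrow> r i \<in> ?T"
      and det: "det (mat (Suc n) (Suc n) (\<lambda>(i,j). A (r i) j)) \<noteq> 0"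
    proof (rule nonsingular_selection[where T = ?T and m = "Suc n" and a = A])
      fix d assume "\<forall>S\<in>?T. (\<Sum>j<Suc n. A S j * d j) = 0"
      then have "\<forall>S\<in>?T. (\<Sum>j<Suc n. a S j * d j) = 0"
        unfolding a_def mult.assoc sum_distrib_left[symmetric] by simp
      then show "\<forall>j<Suc n. d j = 0" using ker by blast
    qed blast
    define M where "M = mat (Suc n) (Suc n) (\<lambda>(i,j). A (r i) j)"
    define v where "v = vec (Suc n) y"
    \<comment> \<open>Cramer's rule for the coordinate 0, which holds \<open>- \<beta>\<close>:
      column 0 gives way to the right-hand side of the tight system, whose entries are values of
      \<open>f\<close>.\<close>
    define N where "N = replace_col M (M *\<^sub>v v) 0"
    have rS: "r i \<subseteq> {1..n}" if "i < Suc n" for i using rT[OF that] by (auto simp: tight_def)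
    have M: "M \<in> carrier_mat (Suc n) (Suc n)" by (simp add: M_def)
    have N: "N \<in> carrier_mat (Suc n) (Suc n)" by (simp add: N_def M_def replace_col_def)
    have M01: "M $$ (i,j) \<in> {0,1}" if "i < Suc n" "j < Suc n" for i j
      using f01[OF rS[OF that(1)]] that by (auto simp: M_def A_def)
    have "(M *\<^sub>v v) $ i = b (r i)" if i: "i < Suc n" for i
    proof -
      have "(M *\<^sub>v v) $ i = (\<Sum>j<Suc n. A (r i) j * y j)"
        using i by (simp add: M_def v_def scalar_prod_def atLeast0LessThan del: sum.lessThan_Suc)
      moreover have "s (r i) * (\<Sum>j<Suc n. A (r i) j * y j) = b (r i)"
        using rT[OF i] unfolding tight_def a_def mult.assoc sum_distrib_left[symmetric] by simp
      \<comment> \<open>The sign is -1 only where the right-hand side is 0, so it can be cancelled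
        from a tight constraint.\<close>
      moreover have "s (r i) * b (r i) = b (r i)" using f01[OF rS[OF i]] by (auto simp: s_def b_def)
      ultimately show ?thesis using s0 by (metis mult_left_cancel)
    qed
    then have N01: "N $$ (i,j) \<in> {0,1}" if "i < Suc n" "j < Suc n" for i j
      using M01[OF that] f01[OF rS[OF that(1)]] that M by (auto simp: N_def replace_col_def b_def)
    have cramer: "det N = y 0 * det M"
      unfolding N_def using cramer_lemma_mat[OF M, of v 0] by (simp add: v_def)
    obtain p where p: "det N = of_int p" "\<bar>p\<bar> \<le> \<lfloor>hadamard01 (Suc n)\<rfloor>" using det_01_int[OF N N01] by blast
    obtain q where q: "det M = of_int q" "\<bar>q\<bar> \<le> \<lfloor>hadamard01 (Suc n)\<rfloor>" using det_01_int[OF M M01] by blast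
    have q0: "q \<noteq> 0" using det q by (auto simp: M_def)
    then have "\<beta> = real_of_int (- p) / real_of_int q"
      using cramer p q by (simp add: \<beta>_def field_simps)
    then show ?thesis unfolding bounded_fractions_def
      by (intro image_eqI[of _ _ "(- p, q)"]) (use p q q0 in auto)
  qed
  ultimately show ?thesis by blast
qed

section \<open>The critical threshold\<close>

lemma roughly_weighted_mono:
  "roughly_weighted n \<alpha> f \<Longrightarrow> \<alpha> \<le> \<beta> \<Longrightarrow> roughly_weighted n \<beta> f"
  unfolding roughly_weighted_def by (meson order_trans)

text \<open>Every feasible threshold dominates a feasible one from a finite set, so a smallest
  feasible threshold \<open>v\<close> exists. It may lie below 1; the requirement
  \<open>\<alpha> \<ge> 1\<close> then lifts the critical value to 1.\<close>

lemma critical_threshold_cases: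
  assumes f: "f \<in> boolean_functions n"
  shows "critical_threshold n f = 1 \<or>
    critical_threshold n f > 1 \<and> critical_threshold n f \<in> bounded_fractions (Suc n)"
proof -
  define V where "V = {\<beta> \<in> bounded_fractions (Suc n). roughly_weighted n \<beta> f}"
  \<comment> \<open>Unit weights give some feasible threshold, so \<open>V\<close> is nonempty and
    the minimum makes sense.\<close>
  have rw: "roughly_weighted n (real n) f"
    unfolding roughly_weighted_def
  proof (intro exI[of _ "\<lambda>_. 1"] conjI allI impI)
    fix S assume S: "S \<subseteq> {1..n}"
    show "real n \<ge> (\<Sum>_\<in>S. 1)" using card_mono[OF _ S] by simp
    assume "f S = 1"
    then have "S \<noteq> {}" using f by (auto simp: boolean_functions_def)
    then have "card S \<ge> 1" using S by (metis One_nat_def Suc_leI card_gt_0_iff finite_atLeastAtMost finite_subset)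
    then show "(\<Sum>_\<in>S. 1::real) \<ge> 1" by simp
  qed
  have low: "\<exists>\<beta>\<in>V. \<beta> \<le> \<alpha>" if "roughly_weighted n \<alpha> f" for \<alpha>
    using roughly_weighted_basic[OF f that] by (auto simp: V_def)
  have V: "finite V" "V \<noteq> {}" using low[OF rw] by (auto simp: V_def bounded_fractions_def)
  define v where "v = Min V"
  have v: "v \<in> V" using V by (simp add: v_def)
  have vle: "v \<le> \<alpha>" if "roughly_weighted n \<alpha> f" for \<alpha>
    using low[OF that] V by (auto simp: v_def intro: order_trans[OF Min_le])
  have "critical_threshold n f = max 1 v"
    unfolding critical_threshold_def
  proof (rule Least_equality)
    show "max 1 v \<ge> 1 \<and> roughly_weighted n (max 1 v) f"
      using v by (auto simp: V_def intro: roughly_weighted_mono[of n v])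
  qed (use vle in auto)
  then show ?thesis using v by (auto simp: V_def max_def)
qed

section \<open>Reduction to lowest terms\<close>

theorem lemma14:
  fixes n :: nat and \<alpha> :: real
  assumes "n \<ge> 1" and "\<alpha> \<in> Spec n"
  shows "\<exists>p q :: int. coprime p q \<and> 1 \<le> q \<and> q \<le> p \<and>
           p \<le> \<lfloor>real (n + 2) powr (real (n + 2) / 2) / 2 ^ (n + 1)\<rfloor> \<and>
           \<alpha> = real_of_int p / real_of_int q"
proof -
  define H where "H = \<lfloor>hadamard01 (Suc n)\<rfloor>"
  have H: "\<lfloor>real (n + 2) powr (real (n + 2) / 2) / 2 ^ (n + 1)\<rfloor> = H"
    by (simp add: H_def hadamard01_def add.commute)
  \<comment> \<open>The identity matrix shows that the bound is at least 1, which admits the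
    fraction 1/1 when \<open>\<alpha> = 1\<close>.\<close>
  have "\<bar>det (1\<^sub>m (Suc n) :: real mat)\<bar> \<le> hadamard01 (Suc n)"
    by (rule det_01_bound) auto
  then have H1: "1 \<le> H" by (simp add: H_def)
  have "\<alpha> = 1 \<or> \<alpha> > 1 \<and> \<alpha> \<in> bounded_fractions (Suc n)"
    using assms(2) critical_threshold_cases by (auto simp: Spec_def)
  then have "\<exists>p q. coprime p q \<and> 1 \<le> q \<and> q \<le> p \<and> p \<le> H \<and> \<alpha> = real_of_int p / real_of_int q"
  proof (elim disjE conjE)
    assume "\<alpha> = 1"
    then show ?thesis using H1 by (intro exI[of _ "1::int"] conjI) simp_all
  next
    assume a1: "\<alpha> > 1" and "\<alpha> \<in> bounded_fractions (Suc n)"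
    then obtain p q where "p \<in> {-H..H}" and pq: "\<alpha> = real_of_int p / real_of_int q" "q \<noteq> 0"
      unfolding bounded_fractions_def H_def by clarsimp blast
    then have pH: "\<bar>p\<bar> \<le> H" by (simp add: abs_le_iff)
    \<comment> \<open>Since \<open>\<alpha>\<close> is positive, signs may be dropped; dividing by
      the gcd makes the pair coprime and only shrinks the numerator, so the bound persists.\<close>
    define p' where "p' = \<bar>p\<bar> div gcd p q"
    define q' where "q' = \<bar>q\<bar> div gcd p q"
    have g: "gcd p q > 0" using pq(2) by simp
    have p': "\<bar>p\<bar> = p' * gcd p q" and q': "\<bar>q\<bar> = q' * gcd p q" by (simp_all add: p'_def q'_def)
    have "\<alpha> = \<bar>\<alpha>\<bar>" using a1 by simp
    also have "\<dots> = real_of_int \<bar>p\<bar> / real_of_int \<bar>q\<bar>" by (simp add: pq(1) abs_divide)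
    finally have eq: "\<alpha> = real_of_int p' / real_of_int q'"
      using pq(2) unfolding p' q' by simp
    have "0 < q' * gcd p q" using pq(2) by (simp flip: q')
    then have q0: "q' > 0" using g by (rule zero_less_mult_pos2)
    then have "q' \<le> p'" using a1 eq by (simp add: field_simps)
    moreover have "p' * 1 \<le> p' * gcd p q"
      by (rule mult_left_mono) (use g q0 \<open>q' \<le> p'\<close> in linarith)+
    then have "p' \<le> \<bar>p\<bar>" by (simp flip: p')
    moreover have "coprime p' q'"
      using div_gcd_coprime[of "\<bar>p\<bar>" "\<bar>q\<bar>"] pq(2) by (simp add: p'_def q'_def)
    ultimately show ?thesis using eq q0 pH by (intro exI[of _ p'] exI[of _ q']) auto
  qed
  then show ?thesis unfolding H .
qed

end
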